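(* Let $p$ be an odd prime, let $e \ge 1$ be an integer, and let $g, c$ be fixed integers with $p \nmid g$ and $p \nmid c$. Let $m = \operatorname{ord}_p(g)$. Let $c' \in \{1, \dots, p^{e-1}(p-1)\}$ be any other value ($c' \neq c$). Let $x_{1,c}, \dots, x_{m,c}$ be an indexing of the $m$ solutions $x \in \{1, \dots, p^e m \mid x \not\equiv 0 \pmod p\}$ of $x g^x \equiv c \pmod{p^e}$, and let $x_{1,c'}, \dots, x_{m,c'}$ be an indexing of the $m$ solutions $x$ in the same set of $x g^x \equiv c' \pmod{p^e}$. If $c' \equiv x_{j,c} \pmod p$ for some $1 \le j \le m$, then for each $x_{i,c'}$ ($1 \le i \le m$) there exists a unique $k$ with $1 \le k \le m$ such that $x_{k,c} \equiv x_{i,c'} \pmod p$.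
   Context: $\operatorname{ord}_p(g)$ denotes the multiplicative order of $g$ modulo $p$. The notation $\{1,\dots,N \mid x\not\equiv 0 \pmod p\}$ denotes the set of integers $x$ with $1 \le x \le N$ and $p \nmid x$. For any integer $b$ with $p \nmid b$, the congruence $x g^x \equiv b \pmod{p^e}$ has exactly $m$ solutions $x$ in $\{1, \dots, p^e m \mid x \not\equiv 0 \pmod p\}$, and they are distinct modulo $m$. *)

theory Defs
  imports "HOL-Number_Theory.Number_Theory"
begin

(* Solutions are positive, so they are taken in nat, which makes g ^ x an ordinary power;
   g and c may be arbitrary integers. The constant ord is polymorphic and is used here
   on integers, although most library lemmas about it are stated for nat. *)
definition sols :: "nat \<Rightarrow> nat \<Rightarrow> int \<Rightarrow> int \<Rightarrow> nat set" where
  "sols p e g c =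
     {x \<in> {1..p ^ e * ord (int p) g}. \<not> p dvd x \<and> [int x * g ^ x = c] (mod int (p ^ e))}"

end

theory Submission
  imports Defs
begin

text \<open>Raising the congruence \<open>g ^ m \<equiv> 1 (mod p)\<close> to the powers \<open>p ^ k\<close> shows that distinct
  elements of \<^term>\<open>sols p e g c\<close> are incongruent modulo \<open>m\<close>; as there are \<open>m\<close> of them, they
  represent every residue class modulo \<open>m\<close>. A solution satisfies \<open>x \<equiv> c g\<^sup>-\<^sup>x (mod p)\<close>, so the
  solutions modulo \<open>p\<close> run exactly once through the coset of \<open>c\<close> by the powers of \<open>g\<close>. If
  \<open>c'\<close> is congruent to some solution for \<open>c\<close>, then \<open>c\<close> and \<open>c'\<close> define the same coset.\<close>

text \<open>Replacing \<open>g\<close> by its least nonnegative residue makes facts about orders of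
  naturals usable for integer bases.\<close>

lemma ord_int_eq_ord_nat:
  fixes n :: nat and g :: int
  assumes "n > 0"
  shows "ord (int n) g = ord n (nat (g mod int n))"
proof -
  define h where "h = nat (g mod int n)"
  have h: "int h = g mod int n"
    using assms by (simp add: h_def)
  have "coprime (int n) g \<longleftrightarrow> coprime n h"
    using assms by (metis coprime_int_iff coprime_mod_right_iff h of_nat_0_less_iff less_irrefl)
  moreover have "[g ^ d = 1] (mod int n) \<longleftrightarrow> [h ^ d = 1] (mod n)" for d
  proof -
    have "[g ^ d = 1] (mod int n) \<longleftrightarrow> [int (h ^ d) = int 1] (mod int n)"
      by (simp add: h cong_def power_mod)
    then show ?thesis
      by (simp only: cong_int_iff)
  qed
  ultimately show ?thesis
    by (simp add: ord_def h_def)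
qed

lemma cong_power_iff_cong_ord_int:
  fixes n :: nat and g :: int
  assumes "n > 0" and "coprime (int n) g"
  shows "[g ^ a = g ^ b] (mod int n) \<longleftrightarrow> [a = b] (mod ord (int n) g)"
proof -
  define h where "h = nat (g mod int n)"
  have h: "int h = g mod int n"
    using assms by (simp add: h_def)
  have "coprime n h"
    using assms by (metis coprime_int_iff coprime_mod_right_iff h of_nat_0_less_iff less_irrefl)
  moreover have "[g ^ a = g ^ b] (mod int n) \<longleftrightarrow> [int (h ^ a) = int (h ^ b)] (mod int n)"
    by (simp add: h cong_def power_mod)
  ultimately show ?thesis
    using assms by (simp only: cong_int_iff ord_int_eq_ord_nat order_divides_expdiff h_def)
qed

text \<open>Fermat's little theorem; it serves to make the order coprime to
  \<open>p\<close>.\<close>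

lemma ord_int_dvd_prime_minus_1:
  fixes p :: nat and g :: int
  assumes "prime p" and "\<not> int p dvd g"
  shows "ord (int p) g dvd p - 1"
proof -
  have p: "p > 0"
    using assms(1) by (rule prime_gt_0_nat)
  have "coprime (int p) g"
    using assms by (simp add: prime_imp_coprime)
  then have "coprime p (nat (g mod int p))"
    using p by (metis coprime_int_iff coprime_mod_right_iff int_nat_eq of_nat_0_less_iff less_irrefl pos_mod_sign)
  then show ?thesis
    using order_divides_totient[of p "nat (g mod int p)"] p assms(1)
    by (simp add: ord_int_eq_ord_nat totient_prime)
qed

text \<open>In \<open>a ^ n - 1 = (a - 1) * (\<Sum>i<n. a ^ i)\<close> the first factor is divisible
  by \<open>q\<close>. The second is a sum of \<open>n\<close> terms congruent to 1 modulo
  \<open>p\<close>, hence divisible by \<open>p = int n\<close>.\<close>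

lemma cong_1_power_lift:
  fixes a :: int
  assumes "[a = 1] (mod q)" and "p dvd q" and "p = int n"
  shows "[a ^ n = 1] (mod q * p)"
proof -
  have "[a = 1] (mod p)"
    using assms by (meson cong_dvd_modulus)
  then have "[(\<Sum>i<n. a ^ i) = (\<Sum>i<n. 1 ^ i)] (mod p)"
    by (intro cong_sum cong_pow)
  then have "p dvd (\<Sum>i<n. a ^ i)"
    using assms(3) by (simp add: cong_def dvd_eq_mod_eq_0)
  moreover have "q dvd a - 1"
    using assms(1) by (simp add: cong_iff_dvd_diff)
  ultimately have "q * p dvd (a - 1) * (\<Sum>i<n. a ^ i)"
    by (rule mult_dvd_mono[rotated])
  then show ?thesis
    by (simp add: cong_iff_dvd_diff power_diff_1_eq)
qed

lemma cong_1_power_prime_power: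
  fixes a :: int
  assumes "[a = 1] (mod int p)"
  shows "[a ^ (p ^ k) = 1] (mod int (p ^ Suc k))"
proof (induction k)
  case 0
  then show ?case using assms by simp
next
  case (Suc k)
  then have "[(a ^ (p ^ k)) ^ p = 1] (mod int (p ^ Suc k) * int p)"
    by (intro cong_1_power_lift) auto
  then show ?case
    by (simp add: power_mult[symmetric] mult_ac)
qed

lemma sols_eq_if_cong:
  assumes p: "prime p" and g: "\<not> int p dvd g"
    and r: "r \<in> sols p e g c" and s: "s \<in> sols p e g c"
    and cong: "[r = s] (mod ord (int p) g)"
  shows "r = s"
  using r s cong
\<comment> \<open>By symmetry \<open>s \<le> r\<close> may be assumed, so that the difference
  \<open>d\<close> is natural and can serve as an exponent.\<close>
proof (induction s r rule: linorder_wlog)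
  case (le s r)
  define m where "m = ord (int p) g"
  obtain d where d: "r = s + d"
    using le(1) by (auto simp: le_iff_add)
  have cop: "coprime (int p) g"
    using p g by (simp add: prime_imp_coprime)
  have p0: "p > 1"
    using p by (rule prime_gt_1_nat)
  have md: "m dvd d"
    using le(4) unfolding d m_def by (metis cong_add_lcancel_0_nat cong_0_iff)
  have mp: "m dvd p - 1"
    unfolding m_def using p g by (rule ord_int_dvd_prime_minus_1)
  then have "m \<le> p - 1" "m > 0"
    using p0 by (auto intro: dvd_imp_le dvd_pos_nat[of "p - 1"])
  \<comment> \<open>Coprimality of \<open>p\<close> and \<open>m\<close> allows divisibility of
    \<open>d\<close> by \<open>m\<close> and by a power of \<open>p\<close> to be multiplied
    together.\<close>
  then have "\<not> p dvd m"
    using p0 by (auto dest: dvd_imp_le)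
  then have copm: "coprime p m"
    using p by (simp add: prime_imp_coprime)
  have gm: "[g ^ m = 1] (mod int p)"
    using cong_power_iff_cong_ord_int[OF _ cop, of m 0] p0 by (simp add: m_def cong_0_iff)
  have eq: "[int r * g ^ d = int s] (mod int (p ^ e))"
  proof -
    have "[int r * g ^ d * g ^ s = int s * g ^ s] (mod int (p ^ e))"
      using cong_trans[OF _ cong_sym, of "int r * g ^ r" c "int (p ^ e)" "int s * g ^ s"] le(2,3)
      by (simp add: sols_def d power_add mult_ac)
    moreover have "coprime (g ^ s) (int (p ^ e))"
      using cop by (simp add: coprime_commute)
    ultimately show ?thesis
      by (simp add: cong_mult_rcancel)
  qed
  \<comment> \<open>A bootstrap: if \<open>m * p ^ k\<close> divides \<open>d\<close>, then
    \<open>g ^ d\<close> is 1 modulo \<open>p ^ Suc k\<close>, so \<open>eq\<close> collapses to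
    \<open>r \<equiv> s\<close> for that modulus, and \<open>d\<close> gains one more factor
    \<open>p\<close>.\<close>
  have "p ^ k dvd d" if "k \<le> e" for k
    using that
  proof (induction k)
    case 0
    then show ?case by simp
  next
    case (Suc k)
    then have "m * p ^ k dvd d"
      using md copm by (intro divides_mult) (auto simp: coprime_commute)
    then obtain t where t: "d = m * p ^ k * t" ..
    have "[((g ^ m) ^ (p ^ k)) ^ t = 1 ^ t] (mod int (p ^ Suc k))"
      using gm by (intro cong_pow cong_1_power_prime_power)
    then have "[g ^ d = 1] (mod int (p ^ Suc k))"
      by (simp add: t power_mult)
    then have "[int r * g ^ d = int r * 1] (mod int (p ^ Suc k))"
      by (rule cong_scalar_left)
    moreover have "[int r * g ^ d = int s] (mod int (p ^ Suc k))"
      using eq Suc.prems by (meson cong_dvd_modulus le_imp_power_dvd of_nat_dvd_iff)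
    ultimately have "[int r = int s] (mod int (p ^ Suc k))"
      by (metis cong_sym cong_trans mult.right_neutral)
    then show ?case
      unfolding cong_int_iff d by (metis cong_add_lcancel_0_nat cong_0_iff)
  qed
  then have "p ^ e * m dvd d"
    using md copm by (intro divides_mult) auto
  \<comment> \<open>Strict because \<open>s \<ge> 1\<close> while
    \<open>r \<le> p ^ e * m\<close>.\<close>
  moreover have "d < p ^ e * m"
    using le(2,3) by (auto simp: sols_def d m_def)
  ultimately have "d = 0"
    by (auto dest: dvd_imp_le)
  then show ?case
    by (simp add: d)
next
  case (sym s r)
  then show ?case by (metis cong_sym)
qed

text \<open>Pigeonhole: \<open>m\<close> distinct residues modulo \<open>m\<close> exhaust all
  residues.\<close>

lemma inj_on_imp_surj_mod:
  fixes f :: "'a \<Rightarrow> nat"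
  assumes "finite A" and "card A = m" and "m > 0"
    and "\<And>i j. i \<in> A \<Longrightarrow> j \<in> A \<Longrightarrow> [f i = f j] (mod m) \<Longrightarrow> i = j"
  shows "\<exists>k\<in>A. [f k = n] (mod m)"
proof -
  have "inj_on (\<lambda>i. f i mod m) A"
    using assms(4) by (auto simp: inj_on_def cong_def)
  then have "card ((\<lambda>i. f i mod m) ` A) = card {..<m}"
    using assms(2) by (simp add: card_image)
  then have "(\<lambda>i. f i mod m) ` A = {..<m}"
    using assms(3) by (intro card_subset_eq) auto
  moreover have "n mod m \<in> {..<m}"
    using assms(3) by simp
  ultimately show ?thesis
    unfolding cong_def by (metis (no_types, lifting) imageE)
qed

lemma sols_cong_mod_prime:
  assumes "r \<in> sols p e g c" and "e \<ge> 1"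
  shows "[int r * g ^ r = c] (mod int p)"
proof -
  have "int p dvd int (p ^ e)"
    using assms(2) by (simp add: dvd_power)
  then show ?thesis
    using assms(1) by (auto simp: sols_def intro: cong_dvd_modulus)
qed

theorem theorem11:
  fixes p e m :: nat and g c c' :: int and x x' :: "nat \<Rightarrow> nat"
  assumes "prime p" and "odd p" and "e \<ge> 1"
    and "\<not> int p dvd g" and "\<not> int p dvd c"
    and "m = ord (int p) g"
    and "c' \<in> {1..int (p ^ (e - 1) * (p - 1))}" and "c' \<noteq> c"
    and "bij_betw x {1..m} (sols p e g c)"
    and "bij_betw x' {1..m} (sols p e g c')"
    and "\<exists>j\<in>{1..m}. [c' = int (x j)] (mod int p)"
  shows "\<forall>i\<in>{1..m}. \<exists>!k. k \<in> {1..m} \<and> [x k = x' i] (mod p)"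
proof
  fix i assume i: "i \<in> {1..m}"
  obtain j where j: "j \<in> {1..m}" "[c' = int (x j)] (mod int p)"
    using assms(11) by blast
  have p0: "p > 0"
    using assms(1) by (rule prime_gt_0_nat)
  have cop: "coprime (int p) g"
    using assms(1,4) by (simp add: prime_imp_coprime)
  note pow_cong = cong_power_iff_cong_ord_int[OF p0 cop, folded assms(6)]
  have cancel: "[a = b] (mod int p)" if "[a * g ^ n = b * g ^ n] (mod int p)" for a b n
    using that cop by (simp add: cong_mult_rcancel coprime_commute)
  have sol: "x k \<in> sols p e g c" "x' k \<in> sols p e g c'" if "k \<in> {1..m}" for k
    using that assms(9,10) by (auto dest: bij_betwE)
  have x: "[int (x k) * g ^ x k = c] (mod int p)" if "k \<in> {1..m}" for k
    using sol(1)[OF that] assms(3) by (rule sols_cong_mod_prime)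
  have inj: "k = l" if "k \<in> {1..m}" "l \<in> {1..m}" "[x k = x l] (mod m)" for k l
  proof -
    have "x k = x l"
      using that(3) unfolding assms(6)
      by (rule sols_eq_if_cong[OF assms(1,4) sol(1)[OF that(1)] sol(1)[OF that(2)]])
    then show ?thesis
      using that(1,2) assms(9) by (auto simp: bij_betw_def dest: inj_onD)
  qed
  \<comment> \<open>The exponent is forced: modulo \<open>p\<close>, \<open>x' i\<close> is
    \<open>c'\<close> over \<open>g ^ x' i\<close>, and \<open>c'\<close> is \<open>x j\<close>,
    which is \<open>c\<close> over \<open>g ^ x j\<close>. Hence \<open>x' i\<close> is
    \<open>c\<close> over \<open>g ^ (x j + x' i)\<close>.\<close>
  obtain k where k: "k \<in> {1..m}" "[x k = x j + x' i] (mod m)"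
  proof -
    have "\<exists>k\<in>{1..m}. [x k = x j + x' i] (mod m)"
      using i inj by (intro inj_on_imp_surj_mod) simp_all
    then show ?thesis
      using that by blast
  qed
  have "[int (x' i) * g ^ x k = int (x' i) * g ^ (x j + x' i)] (mod int p)"
    using k(2) by (intro cong_scalar_left) (simp add: pow_cong)
  also have "int (x' i) * g ^ (x j + x' i) = (int (x' i) * g ^ x' i) * g ^ x j"
    by (simp add: power_add)
  also have "[\<dots> = c' * g ^ x j] (mod int p)"
    using sols_cong_mod_prime[OF sol(2)[OF i] assms(3)] by (rule cong_scalar_right)
  also have "[c' * g ^ x j = int (x j) * g ^ x j] (mod int p)"
    using j(2) by (rule cong_scalar_right)
  also have "[int (x j) * g ^ x j = c] (mod int p)"
    by (rule x[OF j(1)])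
  also have "[c = int (x k) * g ^ x k] (mod int p)"
    using x[OF k(1)] by (rule cong_sym)
  finally have "[x' i = x k] (mod p)"
    by (simp only: cancel flip: cong_int_iff)
  \<comment> \<open>As \<open>p\<close> does not divide \<open>x k\<close>, it cancels from the two
    congruences for \<open>c\<close>. The powers of \<open>g\<close> then agree modulo
    \<open>p\<close>, so \<open>x l\<close> and \<open>x k\<close> agree modulo
    \<open>m\<close>.\<close>
  moreover have "l = k" if l: "l \<in> {1..m}" "[x l = x k] (mod p)" for l
  proof -
    have "[int (x k) * g ^ x l = int (x l) * g ^ x l] (mod int p)"
      using l(2) by (intro cong_scalar_right) (simp add: cong_int_iff cong_sym)
    also have "[int (x l) * g ^ x l = int (x k) * g ^ x k] (mod int p)"
      using x[OF l(1)] x[OF k(1)] by (metis cong_sym cong_trans)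
    finally have "[g ^ x l = g ^ x k] (mod int p)"
      using sol(1)[OF k(1)] assms(1)
      by (subst (asm) cong_mult_lcancel)
         (auto simp: sols_def coprime_commute prime_imp_coprime)
    then show ?thesis
      using inj l(1) k(1) by (simp add: pow_cong)
  qed
  ultimately show "\<exists>!k. k \<in> {1..m} \<and> [x k = x' i] (mod p)"
    using k(1) by (metis cong_sym cong_trans)
qed

end
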